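(* Let $n\ge 2$, $m\ge 1$ be integers, $x^1,\ldots,x^m\in\mathbb{R}^n$, $\omega_1,\ldots,\omega_m>0$, and let $\rho\in(0,1)$ with $\rho/m<1/2$. Let $\widetilde{x}$ be a solution returned by the randomized algorithm for $({\rm P_{ball}})$ described in the context, i.e. $\widetilde x\in\mathbb{R}^n$ with $\|\widetilde{x}\|=1$ and $$\sqrt{n}\,(x^i)^T\widetilde{x}<S^{-1}\!\left(n,\tfrac{\rho}{m}\right)\|x^i\|\quad\text{for all } i\in\{1,\ldots,m\}\text{ with }\|x^i\|>0.$$ Then $$v({\rm CR_{ball}})\ge v({\rm P_{ball}})\ge f(\widetilde{x})>r\cdot v({\rm CR_{ball}})\ge r\cdot v({\rm P_{ball}}),$$ where the approximation bound $r$ satisfies $$r=\frac{1-\frac{S^{-1}\left(n,\frac{\rho}{m}\right)}{\sqrt{n}}}{2}>\frac{1-\sqrt{\frac{20}{9n}\ln\left(\frac{m}{\rho}\right)}}{2}.$$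
   Context: $\|\cdot\|$ is the Euclidean norm. Let $f(x)=\min_{i=1,\ldots,m}\omega_i\|x-x^i\|^2$. The problem $({\rm P_{ball}})$ is $\max_{\|x\|\le1}f(x)$, with optimal value $v({\rm P_{ball}})$. Its convex relaxation $({\rm CR_{ball}})$ is $$\max_{x\in\mathbb{R}^n,\ \zeta\in\mathbb{R}}\ \zeta\quad\text{s.t.}\quad \omega_i\left(1-2(x^i)^Tx+\|x^i\|^2\right)\ge\zeta,\ i=1,\ldots,m,\quad \|x\|\le 1,$$ with optimal value $v({\rm CR_{ball}})$. For $n\ge2$ and $\alpha\in(0,\sqrt n]$ let $$S(n,\alpha)=\frac{\int_{\alpha/\sqrt{n}}^{1}\left(\sqrt{1-t^2}\right)^{n-3}dt}{2\int_{0}^{1}\left(\sqrt{1-t^2}\right)^{n-3}dt}.$$ For fixed $n$ this is strictly decreasing in $\alpha\in(0,\sqrt n)$ with range $(0,1/2)$; for $\beta\in(0,1/2)$, $S^{-1}(n,\beta)\in(0,\sqrt n)$ denotes the unique $\alpha\in(0,\sqrt n)$ with $S(n,\alpha)=\beta$. The algorithm: (1) input $\rho\in(0,1)$ and $x^1,\ldots,x^m$, and set $\alpha=S^{-1}(n,\rho/m)$; (2) repeatedly generate $\zeta$ uniformly at random on the unit sphere of $\mathbb{R}^n$ until $\sqrt{n}\,(x^i)^T\zeta<\alpha\|x^i\|$ for all $i$ with $\|x^i\|>0$; (3) output $\widetilde{x}=\zeta$. *)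

theory Defs
  imports "HOL-Analysis.Analysis"
begin

text \<open>The points $x^1,\dots,x^m$ and the weights are functions on \<open>nat\<close>, of which only the
  values on \<open>{1..m}\<close> are used.\<close>

definition P_obj :: "nat \<Rightarrow> (nat \<Rightarrow> real) \<Rightarrow> (nat \<Rightarrow> real ^ 'n) \<Rightarrow> real ^ 'n \<Rightarrow> real" where
  "P_obj m \<omega> xs x = (MIN i\<in>{1..m}. \<omega> i * (norm (x - xs i))\<^sup>2)"

definition v_P_ball :: "nat \<Rightarrow> (nat \<Rightarrow> real) \<Rightarrow> (nat \<Rightarrow> real ^ 'n) \<Rightarrow> real" where
  "v_P_ball m \<omega> xs = (SUP x\<in>{x. norm x \<le> 1}. P_obj m \<omega> xs x)"

definition CR_feasible ::
    "nat \<Rightarrow> (nat \<Rightarrow> real) \<Rightarrow> (nat \<Rightarrow> real ^ 'n) \<Rightarrow> ((real ^ 'n) \<times> real) set" where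
  "CR_feasible m \<omega> xs =
     {(x, \<zeta>). (\<forall>i\<in>{1..m}. \<omega> i * (1 - 2 * (xs i \<bullet> x) + (norm (xs i))\<^sup>2) \<ge> \<zeta>) \<and> norm x \<le> 1}"

definition v_CR_ball :: "nat \<Rightarrow> (nat \<Rightarrow> real) \<Rightarrow> (nat \<Rightarrow> real ^ 'n) \<Rightarrow> real" where
  "v_CR_ball m \<omega> xs = (SUP (x, \<zeta>)\<in>CR_feasible m \<omega> xs. \<zeta>)"

text \<open>The exponent $n-3$ is an integer and equals $-1$ for $n = 2$. In that case the integrand is
  unbounded near \<open>t = 1\<close>, but it is still integrable; its value at the single point \<open>t = 1\<close>
  does not matter.\<close>

definition cap_S :: "nat \<Rightarrow> real \<Rightarrow> real" where
  "cap_S n \<alpha> =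
     integral {\<alpha> / sqrt (real n)..1} (\<lambda>t. sqrt (1 - t\<^sup>2) powi (int n - 3)) /
     (2 * integral {0..1} (\<lambda>t. sqrt (1 - t\<^sup>2) powi (int n - 3)))"

definition cap_S_inv :: "nat \<Rightarrow> real \<Rightarrow> real" where
  "cap_S_inv n \<beta> = the_inv_into {0<..<sqrt (real n)} (cap_S n) \<beta>"

end

theory Submission
  imports Defs
begin

text \<open>Let \<open>a = S\<^sup>-\<^sup>1(n, \<rho>/m) / sqrt n\<close>, so \<open>0 < a < 1\<close> and \<open>r = (1 - a) / 2\<close>. For each \<open>i\<close>,
  \<open>2 |x\<^sup>i| \<le> 1 + |x\<^sup>i|\<^sup>2\<close> gives on the one hand
  \<open>v(CR) \<le> \<omega>\<^sub>i (1 + |x\<^sup>i|)\<^sup>2 \<le> 2 \<omega>\<^sub>i (1 + |x\<^sup>i|\<^sup>2)\<close> and on the other hand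
  \<open>\<omega>\<^sub>i |xt - x\<^sup>i|\<^sup>2 > \<omega>\<^sub>i (1 - 2 a |x\<^sup>i| + |x\<^sup>i|\<^sup>2) \<ge> (1 - a) \<omega>\<^sub>i (1 + |x\<^sup>i|\<^sup>2)\<close>.
  The bound on \<open>r\<close> rests on the cap estimate
  \<open>S(n, \<alpha>) \<le> (1 - a\<^sup>2)\<^bsup>(n-1)/2\<^esup> / 2 \<le> exp (- (n - 1) a\<^sup>2 / 2) / 2\<close> for \<open>a = \<alpha> / sqrt n\<close>.\<close>

section \<open>The cap function\<close>

definition cap_weight :: "nat \<Rightarrow> real \<Rightarrow> real" where
  "cap_weight n t = sqrt (1 - t\<^sup>2) powi (int n - 3)"

text \<open>Up to normalisation, the probability that a fixed coordinate of a uniform point on the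
  unit sphere of R^n is at least \<open>a\<close>. The variable is rescaled: \<open>a\<close> stands
  for \<alpha> / sqrt n.\<close>

definition cap_tail :: "nat \<Rightarrow> real \<Rightarrow> real" where
  "cap_tail n a = integral {a..1} (cap_weight n)"

lemma cap_S_eq_cap_tail: "cap_S n \<alpha> = cap_tail n (\<alpha> / sqrt (real n)) / (2 * cap_tail n 0)"
  unfolding cap_S_def cap_tail_def cap_weight_def[abs_def] by simp

lemma one_minus_square_pos: "0 < 1 - t\<^sup>2" if "0 \<le> t" "t < 1" for t :: real
  using that by (simp add: power_less_one_iff)

lemma cap_weight_pos: "0 \<le> t \<Longrightarrow> t < 1 \<Longrightarrow> 0 < cap_weight n t"
  unfolding cap_weight_def using one_minus_square_pos[of t]
  by (intro zero_less_power_int) simp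

lemma isCont_cap_weight:
  assumes "0 \<le> t" "t < 1"
  shows "isCont (cap_weight n) t"
  unfolding cap_weight_def[abs_def]
  using one_minus_square_pos[OF assms] by (intro continuous_intros) auto

text \<open>For \<open>n = 2\<close> the weight is unbounded near 1, but it is the derivative of
  \<open>arcsin\<close> on the open interval and \<open>arcsin\<close> is continuous up to 1. For
  larger \<open>n\<close> the exponent is nonnegative and the weight is continuous.\<close>

lemma cap_weight_integrable:
  assumes "n \<ge> 2"
  shows "cap_weight n integrable_on {0..1}"
proof (cases "n = 2")
  case True
  have "(cap_weight n has_integral (arcsin 1 - arcsin 0)) {0..1}"
  proof (rule fundamental_theorem_of_calculus_interior)
    show "continuous_on {0..1} arcsin"
      by (rule continuous_on_subset[OF continuous_on_arcsin']) auto
    show "(arcsin has_vector_derivative cap_weight n x) (at x)" if "x \<in> {0<..<1}" for x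
      using DERIV_arcsin[of x] that True
      by (simp add: cap_weight_def power_int_minus has_real_derivative_iff_has_vector_derivative)
  qed simp
  then show ?thesis by blast
next
  case False
  then have "cap_weight n = (\<lambda>t. sqrt (1 - t\<^sup>2) ^ (n - 3))"
    using assms by (auto simp: cap_weight_def power_int_def fun_eq_iff nat_diff_distrib')
  then show ?thesis
    by (simp only:) (intro integrable_continuous_real continuous_intros)
qed

section \<open>Calculus and decay of the tail integral\<close>

context
  fixes n :: nat
  assumes n: "n \<ge> 2"
begin

text \<open>Moves the variable from the lower to the upper limit, where the standard facts on
  indefinite integrals apply.\<close>

lemma cap_tail_eq: "0 \<le> a \<Longrightarrow> a \<le> 1 \<Longrightarrow> cap_tail n a = cap_tail n 0 - integral {0..a} (cap_weight n)"
  unfolding cap_tail_def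
  using Henstock_Kurzweil_Integration.integral_combine[OF _ _ cap_weight_integrable[OF n], of a]
  by simp

lemma continuous_on_cap_tail: "continuous_on {0..1} (cap_tail n)"
proof -
  have "continuous_on {0..1} (\<lambda>a. cap_tail n 0 - integral {0..a} (cap_weight n))"
    by (intro continuous_intros indefinite_integral_continuous_1 cap_weight_integrable[OF n])
  then show ?thesis
    by (rule continuous_on_eq) (simp add: cap_tail_eq[symmetric])
qed

lemma cap_tail_has_derivative:
  assumes "0 < a" "a < 1"
  shows "(cap_tail n has_real_derivative - cap_weight n a) (at a)"
proof -
  have "((\<lambda>u. integral {0..u} (cap_weight n)) has_vector_derivative cap_weight n a)
          (at a within ({0..1} - {}))"
    using assms isCont_cap_weight[of a n]
    by (intro integral_has_vector_derivative_continuous_at cap_weight_integrable[OF n])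
      (auto intro: continuous_at_imp_continuous_at_within)
  then have "((\<lambda>u. integral {0..u} (cap_weight n)) has_real_derivative cap_weight n a) (at a)"
    using assms at_within_Icc_at[of 0 a 1]
    by (simp add: has_real_derivative_iff_has_vector_derivative)
  then have "((\<lambda>u. cap_tail n 0 - integral {0..u} (cap_weight n))
      has_real_derivative - cap_weight n a) (at a)"
    by (auto intro!: derivative_eq_intros)
  \<comment> \<open>\<open>cap_tail_eq\<close> is restricted to [0, 1], so the derivative is
    transferred inside the open unit interval.\<close>
  then show ?thesis
    by (rule has_field_derivative_transform_within_open[where S = "{0<..<1}"])
      (use assms in \<open>auto simp: cap_tail_eq[symmetric]\<close>)
qed

text \<open>The derivative is negative in the interior. At the endpoints only continuity is used,
  since for \<open>n = 2\<close> the weight is unbounded near 1.\<close>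

lemma cap_tail_strict_antimono:
  assumes "0 \<le> a" "a < b" "b \<le> 1"
  shows "cap_tail n b < cap_tail n a"
proof (rule DERIV_neg_imp_decreasing_open[OF assms(2)])
  show "continuous_on {a..b} (cap_tail n)"
    by (rule continuous_on_subset[OF continuous_on_cap_tail]) (use assms in auto)
  show "\<exists>y. (cap_tail n has_real_derivative y) (at x) \<and> y < 0" if "a < x" "x < b" for x
    using cap_tail_has_derivative[of x] cap_weight_pos[of x n] that assms by force
qed

lemma cap_tail_1 [simp]: "cap_tail n 1 = 0"
  by (simp add: cap_tail_def)

lemma cap_tail_0_pos: "0 < cap_tail n 0"
  using cap_tail_strict_antimono[of 0 1] by simp

text \<open>The difference of the two sides vanishes at \<open>a = 0\<close> and \<open>a = 1\<close>, and its derivative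
  \<open>cap_weight n a * (1 - (n - 1) * a * cap_tail n 0)\<close> changes sign once, from positive to
  negative.\<close>

lemma cap_tail_le:
  assumes "0 \<le> a" "a \<le> 1"
  shows "cap_tail n a \<le> sqrt (1 - a\<^sup>2) ^ (n - 1) * cap_tail n 0"
proof -
  define G where "G = cap_tail n 0"
  define H where "H = (\<lambda>a. sqrt (1 - a\<^sup>2) ^ (n - 1) * G - cap_tail n a)"
  have G: "G > 0"
    unfolding G_def by (rule cap_tail_0_pos)
  have cont: "continuous_on {0..1} H"
    unfolding H_def by (intro continuous_intros continuous_on_cap_tail)
  have der: "(H has_real_derivative cap_weight n x * (1 - real (n - 1) * x * G)) (at x)"
    if x: "0 < x" "x < 1" for x
  proof -
    define s where "s = sqrt (1 - x\<^sup>2)"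
    have s: "s > 0"
      unfolding s_def using one_minus_square_pos[of x] x by simp
    \<comment> \<open>Splitting n - 3 as (n - 2) - 1 exposes the natural power that also occurs in
      the derivative of \<open>s ^ (n - 1)\<close>, so that \<open>cap_weight n x\<close> can be
      factored out.\<close>
    have w: "cap_weight n x = s ^ (n - 2) / s"
    proof -
      have "cap_weight n x = s powi (int (n - 2) - 1)"
        using n by (simp add: cap_weight_def s_def of_nat_diff)
      also have "\<dots> = s ^ (n - 2) / s"
        using s by (subst power_int_diff) auto
      finally show ?thesis .
    qed
    have "((\<lambda>x. sqrt (1 - x\<^sup>2)) has_real_derivative (- x / s)) (at x)"
      unfolding s_def using one_minus_square_pos[of x] x
      by (auto intro!: derivative_eq_intros simp: field_simps)
    from DERIV_diff[OF DERIV_cmult_right[OF DERIV_power[OF this, of "n - 1"], of G]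
        cap_tail_has_derivative[OF x]]
    have "(H has_real_derivative
        real (n - 1) * ((- x / s) * s ^ (n - 2)) * G + cap_weight n x) (at x)"
      by (simp add: H_def s_def numeral_2_eq_2)
    also have "real (n - 1) * ((- x / s) * s ^ (n - 2)) * G + cap_weight n x
        = cap_weight n x * (1 - real (n - 1) * x * G)"
      unfolding w using s by (simp add: field_simps)
    finally show ?thesis .
  qed
  have "0 \<le> H a"
  \<comment> \<open>Left of the sign change \<open>H\<close> has increased from its zero at 0; right
    of it \<open>H\<close> still decreases to its zero at 1.\<close>
  proof (cases "real (n - 1) * a * G \<le> 1")
    case True
    have "H 0 \<le> H a"
    proof (rule DERIV_nonneg_imp_increasing_open[OF assms(1)])
      show "continuous_on {0..a} H"
        by (rule continuous_on_subset[OF cont]) (use assms in auto)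
      fix x assume x: "0 < x" "x < a"
      have "real (n - 1) * x * G \<le> real (n - 1) * a * G"
        using x G by (intro mult_right_mono mult_left_mono) auto
      then have "0 \<le> cap_weight n x * (1 - real (n - 1) * x * G)"
        using True cap_weight_pos[of x n] x assms by simp
      then show "\<exists>y. (H has_real_derivative y) (at x) \<and> 0 \<le> y"
        using der[of x] x assms by auto
    qed
    then show ?thesis by (simp add: H_def G_def)
  next
    case False
    have "H 1 \<le> H a"
    proof (rule DERIV_nonpos_imp_decreasing_open[OF assms(2)])
      show "continuous_on {a..1} H"
        by (rule continuous_on_subset[OF cont]) (use assms in auto)
      fix x assume x: "a < x" "x < 1"
      have "real (n - 1) * a * G \<le> real (n - 1) * x * G"
        using x G by (intro mult_right_mono mult_left_mono) auto
      then have "1 - real (n - 1) * x * G \<le> 0"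
        using False by linarith
      then have "cap_weight n x * (1 - real (n - 1) * x * G) \<le> 0"
        using cap_weight_pos[of x n] x assms by (simp only: mult_le_0_iff) auto
      then show "\<exists>y. (H has_real_derivative y) (at x) \<and> y \<le> 0"
        using der[of x] x assms by auto
    qed
    \<comment> \<open>\<open>H 1 = 0\<close> because the exponent \<open>n - 1\<close> is
      positive.\<close>
    then show ?thesis using n by (simp add: H_def power_0_left)
  qed
  then show ?thesis by (simp add: H_def G_def)
qed

section \<open>The inverse of the cap function and its upper bound\<close>

lemma cap_S_strict_antimono:
  assumes "0 \<le> \<alpha>" "\<alpha> < \<beta>" "\<beta> \<le> sqrt (real n)"
  shows "cap_S n \<beta> < cap_S n \<alpha>"
  unfolding cap_S_eq_cap_tail using assms cap_tail_0_pos n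
  by (intro divide_strict_right_mono cap_tail_strict_antimono) (auto simp: field_simps)

text \<open>\<open>the_inv_into\<close> is meaningful here because \<open>cap_S\<close> is injective
  by strict monotonicity and attains \<beta> by the intermediate value theorem.\<close>

lemma
  assumes "0 < \<beta>" "\<beta> < 1 / 2"
  shows cap_S_inv_mem: "cap_S_inv n \<beta> \<in> {0<..<sqrt (real n)}"
    and cap_S_cap_S_inv: "cap_S n (cap_S_inv n \<beta>) = \<beta>"
proof -
  have "inj_on (cap_S n) {0<..<sqrt (real n)}"
  proof (rule linorder_inj_onI')
    show "cap_S n \<alpha> \<noteq> cap_S n \<gamma>"
      if "\<alpha> \<in> {0<..<sqrt (real n)}" "\<gamma> \<in> {0<..<sqrt (real n)}" "\<alpha> < \<gamma>" for \<alpha> \<gamma>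
      using cap_S_strict_antimono[of \<alpha> \<gamma>] that by simp
  qed
  moreover have "\<beta> \<in> cap_S n ` {0<..<sqrt (real n)}"
  proof -
    have sn: "sqrt (real n) > 0"
      using n by simp
    have "\<exists>a\<ge>0. a \<le> 1 \<and> cap_tail n a = 2 * \<beta> * cap_tail n 0"
    proof (rule IVT2')
      show "cap_tail n 1 \<le> 2 * \<beta> * cap_tail n 0" "2 * \<beta> * cap_tail n 0 \<le> cap_tail n 0"
        using assms cap_tail_0_pos by auto
    qed (simp_all add: continuous_on_cap_tail)
    then obtain a where a: "0 \<le> a" "a \<le> 1" "cap_tail n a = 2 * \<beta> * cap_tail n 0"
      by blast
    \<comment> \<open>The tail ratio is 1 at 0 and 0 at 1, whereas 2 \<beta> lies strictly
      between.\<close>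
    moreover have "a \<noteq> 0" "a \<noteq> 1"
      using a(3) assms cap_tail_0_pos by auto
    ultimately have "a * sqrt (real n) \<in> {0<..<sqrt (real n)}"
      using sn by auto
    moreover have "cap_S n (a * sqrt (real n)) = \<beta>"
      using a(3) sn cap_tail_0_pos by (simp add: cap_S_eq_cap_tail)
    ultimately show ?thesis by blast
  qed
  ultimately show "cap_S_inv n \<beta> \<in> {0<..<sqrt (real n)}" "cap_S n (cap_S_inv n \<beta>) = \<beta>"
    unfolding cap_S_inv_def by (auto intro: f_the_inv_into_f the_inv_into_into[OF _ _ order_refl]
        simp del: greaterThanLessThan_iff)
qed

text \<open>Inserts 1 - a^2 \<le> exp (- a^2) into \<open>cap_tail_le\<close>. The outer factor 1/2
  is kept because it yields the \<open>ln 2\<close> that later absorbs the loss from n - 1 against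
  n.\<close>

lemma cap_S_le_exp:
  assumes "0 \<le> \<alpha>" "\<alpha> \<le> sqrt (real n)"
  shows "cap_S n \<alpha> \<le> exp (- (real n - 1) * (\<alpha> / sqrt (real n))\<^sup>2 / 2) / 2"
proof -
  define a where "a = \<alpha> / sqrt (real n)"
  have a: "0 \<le> a" "a \<le> 1"
    unfolding a_def using assms n by (auto simp: field_simps)
  have "sqrt (1 - a\<^sup>2) \<le> sqrt (exp (- a\<^sup>2))"
    using exp_ge_add_one_self[of "- a\<^sup>2"] by simp
  also have "\<dots> = exp (- a\<^sup>2 / 2)"
    by (rule real_sqrt_unique) (simp_all flip: exp_of_nat_mult)
  finally have "sqrt (1 - a\<^sup>2) ^ (n - 1) \<le> exp (- a\<^sup>2 / 2) ^ (n - 1)"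
    using a by (intro power_mono) (auto simp: power_le_one)
  also have "\<dots> = exp (- (real n - 1) * a\<^sup>2 / 2)"
    using n by (simp add: of_nat_diff field_simps flip: exp_of_nat_mult)
  finally have "sqrt (1 - a\<^sup>2) ^ (n - 1) * cap_tail n 0
      \<le> exp (- (real n - 1) * a\<^sup>2 / 2) * cap_tail n 0"
    using cap_tail_0_pos by simp
  then have "cap_tail n a \<le> exp (- (real n - 1) * a\<^sup>2 / 2) * cap_tail n 0"
    using cap_tail_le[OF a] by linarith
  then show ?thesis
    unfolding cap_S_eq_cap_tail a_def[symmetric] using cap_tail_0_pos by (simp add: field_simps)
qed

text \<open>Evaluates \<open>cap_S_le_exp\<close> at the inverse, where its left side is \<beta>,
  and solves for the square of \<open>a\<close> by taking logarithms.\<close>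

lemma cap_S_inv_less:
  assumes "0 < \<beta>" "\<beta> < 1 / 2"
  shows "cap_S_inv n \<beta> / sqrt (real n) < sqrt (20 / (9 * real n) * ln (1 / \<beta>))"
proof -
  define a where "a = cap_S_inv n \<beta> / sqrt (real n)"
  have \<alpha>: "0 < cap_S_inv n \<beta>" "cap_S_inv n \<beta> < sqrt (real n)"
    using cap_S_inv_mem[OF assms] by auto
  have a: "0 < a" "a < 1"
    unfolding a_def using \<alpha> n by (auto simp: field_simps)
  have "\<beta> \<le> exp (- (real n - 1) * a\<^sup>2 / 2) / 2"
    using cap_S_le_exp[of "cap_S_inv n \<beta>"] \<alpha> cap_S_cap_S_inv[OF assms] by (simp add: a_def)
  then have "ln \<beta> \<le> ln (exp (- (real n - 1) * a\<^sup>2 / 2) / 2)"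
    using assms by (subst ln_le_cancel_iff) auto
  then have "ln 2 + (real n - 1) * a\<^sup>2 / 2 \<le> ln (1 / \<beta>)"
    using assms by (simp add: ln_div field_simps)
  moreover have "a\<^sup>2 < 1" "0 \<le> real n * a\<^sup>2"
    using a by (simp_all add: power_less_one_iff)
  moreover have "(real n - 1) * a\<^sup>2 = real n * a\<^sup>2 - a\<^sup>2"
    by (simp add: left_diff_distrib)
  \<comment> \<open>With L = ln (1 / \<beta>), the bounds ln 2 \<ge> 2/3 and a^2 < 1 give n a^2 < 2
    L - 4/3 + 1 < 2 L. They also give L > 0, so 2 L is at most (20/9) L.\<close>
  ultimately have "9 * (real n * a\<^sup>2) < 20 * ln (1 / \<beta>)"
    using ln2_ge_two_thirds by linarith
  then have "a\<^sup>2 < 20 / (9 * real n) * ln (1 / \<beta>)"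
    using n by (simp add: field_simps)
  then show ?thesis
    unfolding a_def[symmetric] by (rule real_less_rsqrt)
qed

end

section \<open>The optimal values\<close>

lemma P_obj_le: "i \<in> {1..m} \<Longrightarrow> P_obj m \<omega> xs x \<le> \<omega> i * (norm (x - xs i))\<^sup>2"
  unfolding P_obj_def by (rule Min_le) auto

lemma less_P_obj:
  assumes "m \<ge> 1" "\<And>i. i \<in> {1..m} \<Longrightarrow> c < \<omega> i * (norm (x - xs i))\<^sup>2"
  shows "c < P_obj m \<omega> xs x"
  unfolding P_obj_def using assms by (subst Min_gr_iff) auto

lemma norm_diff_squared:
  "(norm (x - y))\<^sup>2 = (norm x)\<^sup>2 - 2 * (y \<bullet> x) + (norm y)\<^sup>2" for x y :: "'a::real_inner"
  by (simp add: power2_norm_eq_inner inner_diff inner_commute)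

text \<open>Cauchy-Schwarz on the unit ball bounds the linear term. The bound serves both to make
  the supremum finite and to estimate \<open>v_CR_ball\<close> at each index.\<close>

lemma CR_feasible_le:
  assumes "(x, \<zeta>) \<in> CR_feasible m \<omega> xs" "i \<in> {1..m}" "\<omega> i > 0"
  shows "\<zeta> \<le> \<omega> i * (1 + norm (xs i))\<^sup>2"
proof -
  have "- (xs i \<bullet> x) \<le> norm (xs i) * norm x"
    using Cauchy_Schwarz_ineq2[of "xs i" x] by linarith
  also have "\<dots> \<le> norm (xs i) * 1"
    using assms(1) by (intro mult_left_mono) (auto simp: CR_feasible_def)
  finally have "1 - 2 * (xs i \<bullet> x) + (norm (xs i))\<^sup>2 \<le> (1 + norm (xs i))\<^sup>2"
    by (simp add: power2_sum)
  then have "\<omega> i * (1 - 2 * (xs i \<bullet> x) + (norm (xs i))\<^sup>2) \<le> \<omega> i * (1 + norm (xs i))\<^sup>2"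
    using assms(3) by simp
  moreover have "\<zeta> \<le> \<omega> i * (1 - 2 * (xs i \<bullet> x) + (norm (xs i))\<^sup>2)"
    using assms(1,2) by (auto simp: CR_feasible_def)
  ultimately show ?thesis by linarith
qed

section \<open>Relaxation inequalities and the approximation ratio\<close>

context
  fixes m :: nat and \<omega> :: "nat \<Rightarrow> real" and xs :: "nat \<Rightarrow> real ^ 'n"
  assumes m: "m \<ge> 1" and \<omega>: "\<And>i. i \<in> {1..m} \<Longrightarrow> \<omega> i > 0"
begin

lemma bdd_above_CR_feasible: "bdd_above ((\<lambda>(x, \<zeta>). \<zeta>) ` CR_feasible m \<omega> xs)"
  by (rule bdd_aboveI2[where M = "\<omega> 1 * (1 + norm (xs 1))\<^sup>2"])
    (use CR_feasible_le[of _ _ m \<omega> xs 1] m \<omega> in auto)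

text \<open>Expanding the squared distance and replacing the squared norm of \<open>x\<close> by 1
  can only increase it; this is the sense in which the second problem relaxes the first.\<close>

lemma P_obj_CR_feasible:
  assumes "norm x \<le> 1"
  shows "(x, P_obj m \<omega> xs x) \<in> CR_feasible m \<omega> xs"
proof -
  have "P_obj m \<omega> xs x \<le> \<omega> i * (1 - 2 * (xs i \<bullet> x) + (norm (xs i))\<^sup>2)" if "i \<in> {1..m}" for i
  proof -
    have "(norm (x - xs i))\<^sup>2 \<le> 1 - 2 * (xs i \<bullet> x) + (norm (xs i))\<^sup>2"
      using assms by (simp add: norm_diff_squared power_le_one)
    then have "\<omega> i * (norm (x - xs i))\<^sup>2 \<le> \<omega> i * (1 - 2 * (xs i \<bullet> x) + (norm (xs i))\<^sup>2)"
      using \<omega>[OF that] by simp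
    then show ?thesis
      using P_obj_le[OF that] order_trans by blast
  qed
  then show ?thesis using assms by (simp add: CR_feasible_def)
qed

lemma P_obj_le_v_CR_ball: "norm x \<le> 1 \<Longrightarrow> P_obj m \<omega> xs x \<le> v_CR_ball m \<omega> xs"
  unfolding v_CR_ball_def
  using cSUP_upper[OF P_obj_CR_feasible bdd_above_CR_feasible, of x] by simp

lemma v_P_ball_le_v_CR_ball: "v_P_ball m \<omega> xs \<le> v_CR_ball m \<omega> xs"
  unfolding v_P_ball_def using P_obj_le_v_CR_ball
  by (intro cSUP_least) (auto intro!: exI[of _ 0])

lemma P_obj_le_v_P_ball: "norm x \<le> 1 \<Longrightarrow> P_obj m \<omega> xs x \<le> v_P_ball m \<omega> xs"
  unfolding v_P_ball_def
  by (intro cSUP_upper bdd_aboveI2[where M = "v_CR_ball m \<omega> xs"]) (auto intro: P_obj_le_v_CR_ball)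

lemma v_CR_ball_le:
  assumes "i \<in> {1..m}"
  shows "v_CR_ball m \<omega> xs \<le> \<omega> i * (1 + norm (xs i))\<^sup>2"
  unfolding v_CR_ball_def
proof (rule cSUP_least)
  show "CR_feasible m \<omega> xs \<noteq> {}"
    using P_obj_CR_feasible[of 0] by auto
qed (use CR_feasible_le[where m = m and xs = xs and \<omega> = \<omega>] assms \<omega> in auto)

text \<open>The minimum runs over finitely many indices, so a strict inequality at each index
  suffices; \<open>v_CR_ball_le\<close> bounds the left side by a term with the same index.\<close>

lemma approximation_bound:
  assumes xt: "norm xt = 1" and a: "0 < a" "a < 1"
    and avoid: "\<And>i. i \<in> {1..m} \<Longrightarrow> xs i \<noteq> 0 \<Longrightarrow> xs i \<bullet> xt < a * norm (xs i)"
  shows "(1 - a) / 2 * v_CR_ball m \<omega> xs < P_obj m \<omega> xs xt"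
proof (rule less_P_obj[OF m])
  fix i assume i: "i \<in> {1..m}"
  have "(1 - a) / 2 * (1 + norm (xs i))\<^sup>2 < (norm (xt - xs i))\<^sup>2"
  proof (cases "xs i = 0")
    case True
    \<comment> \<open>At a zero point \<open>avoid\<close> says nothing; strictness comes from (1 -
      a) / 2 < 1.\<close>
    then show ?thesis using xt a by simp
  next
    case False
    have "(1 + norm (xs i))\<^sup>2 \<le> 2 * (1 + (norm (xs i))\<^sup>2)"
      using sum_squares_ge_zero[of "1 - norm (xs i)" 0]
      by (simp add: power2_eq_square algebra_simps)
    then have "(1 - a) / 2 * (1 + norm (xs i))\<^sup>2 \<le> (1 - a) / 2 * (2 * (1 + (norm (xs i))\<^sup>2))"
      using a by (intro mult_left_mono) auto
    also have "\<dots> \<le> 1 - 2 * a * norm (xs i) + (norm (xs i))\<^sup>2"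
    proof -
      \<comment> \<open>This is exactly the difference of the two sides.\<close>
      have "0 \<le> a * (1 - norm (xs i))\<^sup>2" using a by simp
      then show ?thesis by (simp add: power2_eq_square field_simps)
    qed
    also have "\<dots> < (norm (xt - xs i))\<^sup>2"
      using avoid[OF i False] xt by (simp add: norm_diff_squared)
    finally show ?thesis .
  qed
  then have "\<omega> i * ((1 - a) / 2 * (1 + norm (xs i))\<^sup>2) < \<omega> i * (norm (xt - xs i))\<^sup>2"
    using \<omega>[OF i] by simp
  moreover have "(1 - a) / 2 * v_CR_ball m \<omega> xs \<le> (1 - a) / 2 * (\<omega> i * (1 + norm (xs i))\<^sup>2)"
    using v_CR_ball_le[OF i] a by (intro mult_left_mono) auto
  ultimately show "(1 - a) / 2 * v_CR_ball m \<omega> xs < \<omega> i * (norm (xt - xs i))\<^sup>2"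
    by (simp add: mult.left_commute)
qed

end

theorem theorem4p4:
  fixes xs :: "nat \<Rightarrow> real ^ 'n" and \<omega> :: "nat \<Rightarrow> real" and m :: nat
    and \<rho> r :: real and xt :: "real ^ 'n"
  assumes "CARD('n) \<ge> 2" and "m \<ge> 1"
    and "\<forall>i\<in>{1..m}. \<omega> i > 0"
    and "0 < \<rho>" and "\<rho> < 1" and "\<rho> / real m < 1 / 2"
    and "norm xt = 1"
    and "\<forall>i\<in>{1..m}. norm (xs i) > 0 \<longrightarrow>
           sqrt (real CARD('n)) * (xs i \<bullet> xt) < cap_S_inv CARD('n) (\<rho> / real m) * norm (xs i)"
    and "r = (1 - cap_S_inv CARD('n) (\<rho> / real m) / sqrt (real CARD('n))) / 2"
  shows "v_CR_ball m \<omega> xs \<ge> v_P_ball m \<omega> xs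
    \<and> v_P_ball m \<omega> xs \<ge> P_obj m \<omega> xs xt
    \<and> P_obj m \<omega> xs xt > r * v_CR_ball m \<omega> xs
    \<and> r * v_CR_ball m \<omega> xs \<ge> r * v_P_ball m \<omega> xs
    \<and> r > (1 - sqrt (20 / (9 * real CARD('n)) * ln (real m / \<rho>))) / 2"
proof -
  define a where "a = cap_S_inv CARD('n) (\<rho> / real m) / sqrt (real CARD('n))"
  have \<beta>: "0 < \<rho> / real m"
    using assms(2,4) by simp
  have \<omega>: "\<And>i. i \<in> {1..m} \<Longrightarrow> \<omega> i > 0"
    using assms(3) by blast
  have a: "0 < a" "a < 1"
    unfolding a_def using cap_S_inv_mem[OF assms(1) \<beta> assms(6)] by (auto simp: field_simps)
  have r: "r = (1 - a) / 2"
    using assms(9) by (simp add: a_def)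
  have "xs i \<bullet> xt < a * norm (xs i)" if "i \<in> {1..m}" "xs i \<noteq> 0" for i
    using assms(8) that by (auto simp: a_def field_simps)
  then have "r * v_CR_ball m \<omega> xs < P_obj m \<omega> xs xt"
    unfolding r using approximation_bound[where xs = xs and \<omega> = \<omega>, OF assms(2) \<omega> assms(7) a] by blast
  \<comment> \<open>Multiplying by \<open>r\<close> preserves the order because \<open>a < 1\<close>
    makes \<open>r\<close> positive.\<close>
  moreover have "r * v_P_ball m \<omega> xs \<le> r * v_CR_ball m \<omega> xs"
    using v_P_ball_le_v_CR_ball[where xs = xs and \<omega> = \<omega>, OF assms(2) \<omega>] a by (intro mult_left_mono) (auto simp: r)
  moreover have "a < sqrt (20 / (9 * real CARD('n)) * ln (real m / \<rho>))"
    using cap_S_inv_less[OF assms(1) \<beta> assms(6)] by (simp add: a_def)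
  ultimately show ?thesis
    using v_P_ball_le_v_CR_ball[where xs = xs and \<omega> = \<omega>, OF assms(2) \<omega>] P_obj_le_v_P_ball[where xs = xs and \<omega> = \<omega>, OF assms(2) \<omega>, where x = xt] assms(7)
    by (simp add: r)
qed

end
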